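(* In online matching with online items and non-myopic offline agents with private graph edges, every tardy deterministic truthful mechanism is prompt; that is, whenever it assigns an item $j$ to a buyer $i$, the payment $p_i$ is already determined by the information (bids on items up to $j$) available upon the arrival of $j$.
   Context: Model. There is a bipartite graph $G=(B,I;E)$ with a set $B$ of $n$ buyers, known in advance, and a set $I$ of $m$ items arriving one by one in an unknown, possibly adversarial order (item $j$ arrives at time $j$). Buyer $i$ is interested in the items $j$ with $(i,j)\in E$, and has a value $v_i\ge 0$ for obtaining at least one item she is interested in (value $0$ otherwise). Private graph edges: both $v_i$ and the set of items $i$ is interested in are private information of $i$. When item $j$ arrives, every buyer declares whether she is interested in $j$ and, if so, a value; she may misreport both. All nonzero bids of buyer $i$ must equal a single value $b_i$ (a bid of $0$ meaning not interested). A deterministic mechanism decides upon the arrival of $j$, immediately and irrevocably and using only the bids on items up to $j$, either to assign $j$ to a buyer who declared interest in it and has not been assigned an item yet, or to leave $j$ unassigned forever. The result is a matching $\mu$ ($\mu^{-1}_i$ is the item received by $i$, $\emptyset$ if none). The mechanism also charges non-negative payments $p_i$. It is tardy if payments are computed at the end of the whole process (so a priori they may depend on all bids), and prompt if the payment $p_i$ of every buyer $i$ is determined upon the assignment of $i$, i.e. upon the arrival of item $\mu_i^{-1}$. Truthfulness. Non-myopic buyers know the whole sequence of items and maximize the quasi-linear utility $u_i=v_i\cdot\mathbb{I}[(i,\mu_i^{-1})\in E]-p_i$. A deterministic mechanism is truthful if, for every instance and every behavior of the other buyers, each agent maximizes her utility by reporting her value and her interests truthfully. Mechanisms are required to be individually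 rational: truthful agents have non-negative utility. *)

theory Defs
  imports Complex_Main
begin

text \<open>
  Items are numbered from 0 in their order of arrival. Entry \<open>k\<close> of a bid sequence is the vector of
  the bids of all buyers on item \<open>k\<close>; bid 0 means ``not interested''.
\<close>

type_synonym 'b bids = "('b \<Rightarrow> real) list"

definition valid_bids :: "'b bids \<Rightarrow> bool" where
  "valid_bids bs \<longleftrightarrow> (\<forall>i. \<exists>v\<ge>0. \<forall>b\<in>set bs. b i = 0 \<or> b i = v)"

text \<open>
  The online constraint is built into the type: \<open>assign M h\<close> is the decision on the last item of the
  history \<open>h\<close>, which contains only the bids on the items that have arrived so far. Payments are
  tardy: \<open>payment M bs\<close> is evaluated on the complete bid sequence. No further argument is needed,
  since past decisions are themselves functions of past bids.
\<close>

record 'b mechanism =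
  assign :: "'b bids \<Rightarrow> 'b option"
  payment :: "'b bids \<Rightarrow> 'b \<Rightarrow> real"

definition assigned :: "'b mechanism \<Rightarrow> 'b bids \<Rightarrow> 'b \<Rightarrow> nat \<Rightarrow> bool" where
  "assigned M bs i k \<longleftrightarrow> k < length bs \<and> assign M (take (Suc k) bs) = Some i"

text \<open>
  The parameter \<open>H\<close> is the set of possible numbers of items. It covers both a number \<open>m\<close> of items
  known in advance (\<open>H = {m}\<close>) and an unknown one (\<open>H = UNIV\<close>); in the latter case decisions cannot
  depend on \<open>m\<close>, whereas payments, computed at the end, can.
\<close>

definition complete_bids :: "nat set \<Rightarrow> 'b bids \<Rightarrow> bool" where
  "complete_bids H bs \<longleftrightarrow> length bs \<in> H \<and> valid_bids bs"

definition tardy_mechanism :: "nat set \<Rightarrow> 'b mechanism \<Rightarrow> bool" where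
  "tardy_mechanism H M \<longleftrightarrow> (\<forall>bs. complete_bids H bs \<longrightarrow>
     (\<forall>i k. assigned M bs i k \<longrightarrow> (bs ! k) i \<noteq> 0 \<and> (\<forall>k'<k. \<not> assigned M bs i k')) \<and>
     (\<forall>i. payment M bs i \<ge> 0))"

definition is_instance :: "nat set \<Rightarrow> nat \<Rightarrow> ('b \<times> nat) set \<Rightarrow> ('b \<Rightarrow> real) \<Rightarrow> bool" where
  "is_instance H m E v \<longleftrightarrow> m \<in> H \<and> E \<subseteq> UNIV \<times> {..<m} \<and> (\<forall>i. v i \<ge> 0)"

definition utility ::
  "'b mechanism \<Rightarrow> ('b \<times> nat) set \<Rightarrow> ('b \<Rightarrow> real) \<Rightarrow> 'b bids \<Rightarrow> 'b \<Rightarrow> real" where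
  "utility M E v bs i =
     v i * of_bool (\<exists>k. assigned M bs i k \<and> (i, k) \<in> E) - payment M bs i"

definition report_truthfully ::
  "('b \<times> nat) set \<Rightarrow> ('b \<Rightarrow> real) \<Rightarrow> 'b \<Rightarrow> 'b bids \<Rightarrow> 'b bids" where
  "report_truthfully E v i bs =
     map (\<lambda>k. (bs ! k)(i := if (i, k) \<in> E then v i else 0)) [0..<length bs]"

text \<open>
  Below, \<open>bs\<close> ranges over all joint behaviors: its column \<open>i\<close> is an arbitrary misreport of buyer \<open>i\<close>
  and its other columns are the arbitrary behavior of the other buyers.
\<close>

definition truthful :: "nat set \<Rightarrow> 'b mechanism \<Rightarrow> bool" where
  "truthful H M \<longleftrightarrow> (\<forall>m E v bs i.
     is_instance H m E v \<and> valid_bids bs \<and> length bs = m \<longrightarrow>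
     utility M E v bs i \<le> utility M E v (report_truthfully E v i bs) i)"

definition individually_rational :: "nat set \<Rightarrow> 'b mechanism \<Rightarrow> bool" where
  "individually_rational H M \<longleftrightarrow> (\<forall>m E v bs i.
     is_instance H m E v \<and> valid_bids bs \<and> length bs = m \<longrightarrow>
     0 \<le> utility M E v (report_truthfully E v i bs) i)"

definition prompt :: "nat set \<Rightarrow> 'b mechanism \<Rightarrow> bool" where
  "prompt H M \<longleftrightarrow> (\<exists>price :: 'b bids \<Rightarrow> 'b \<Rightarrow> real.
     \<forall>bs i k. complete_bids H bs \<and> assigned M bs i k \<longrightarrow>
       payment M bs i = price (take (Suc k) bs) i)"

end

theory Submission imports Defs begin

text \<open>
  Suppose two bid sequences agree up to the item \<open>k\<close> that buyer \<open>i\<close> receives, but charge her \<open>p < p'\<close>.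
  Pick \<open>w\<close> strictly between \<open>p\<close> and \<open>p'\<close> and consider the buyer of value \<open>w\<close> who is interested in \<open>k\<close>
  only. In the cheap sequence she could misreport and obtain utility \<open>w - p > 0\<close>, so her truthful report
  must win \<open>k\<close>. That decision depends only on the common prefix, so the same report also wins \<open>k\<close> in the
  expensive sequence, at a price of at most \<open>w < p'\<close> by individual rationality: a profitable deviation
  for the buyer who is charged \<open>p'\<close>.
\<close>

lemma length_report_truthfully [simp]: "length (report_truthfully E v i bs) = length bs"
  by (simp add: report_truthfully_def)

lemma nth_report_truthfully [simp]:
  "k < length bs \<Longrightarrow>
    report_truthfully E v i bs ! k = (bs ! k)(i := if (i, k) \<in> E then v i else 0)"
  by (simp add: report_truthfully_def)

lemma take_report_truthfully:
  "take n (report_truthfully E v i bs) = report_truthfully E v i (take n bs)"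
  by (rule nth_equalityI) simp_all

lemma valid_bids_report_truthfully:
  assumes "valid_bids bs" and "v i \<ge> 0"
  shows "valid_bids (report_truthfully E v i bs)"
  unfolding valid_bids_def
proof
  fix i'
  obtain u where "u \<ge> 0" and u: "\<forall>b\<in>set bs. b i' = 0 \<or> b i' = u"
    using assms(1) unfolding valid_bids_def by blast
  then show "\<exists>u\<ge>0. \<forall>b\<in>set (report_truthfully E v i bs). b i' = 0 \<or> b i' = u"
    using assms(2)
    by (intro exI[of _ "if i' = i then v i else u"]) (auto simp: report_truthfully_def)
qed

text \<open>Every valid column is the honest report of some type of buyer \<open>i\<close>. The last
  clause says that this honest report restores \<open>bs\<close> after column \<open>i\<close> has
  been overwritten, so an overwritten sequence can be treated as a misreport by that type.\<close>

lemma valid_bids_eq_report_truthfully: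
  assumes "valid_bids bs"
  obtains E v where "E \<subseteq> UNIV \<times> {..<length bs}" "\<forall>j. v j \<ge> 0"
    "\<And>k. k < length bs \<Longrightarrow> (i, k) \<in> E \<longleftrightarrow> (bs ! k) i \<noteq> 0"
    "\<And>F u. report_truthfully E v i (report_truthfully F u i bs) = bs"
proof -
  obtain c where c: "c \<ge> 0" "\<forall>b\<in>set bs. b i = 0 \<or> b i = c"
    using assms unfolding valid_bids_def by blast
  \<comment> \<open>The edges are the nonzero bids, all of which equal \<open>c\<close>; if
    \<open>i\<close> never bids, \<open>E\<close> is empty and the choice of \<open>c\<close> is
    immaterial.\<close>
  define E where "E = {(i, k) | k. k < length bs \<and> (bs ! k) i \<noteq> 0}"
  have mem: "(i, k) \<in> E \<longleftrightarrow> (bs ! k) i \<noteq> 0" if "k < length bs" for k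
    using that by (simp add: E_def)
  have "report_truthfully E (\<lambda>_. c) i (report_truthfully F u i bs) = bs" for F u
  proof (rule nth_equalityI)
    fix k assume "k < length (report_truthfully E (\<lambda>_. c) i (report_truthfully F u i bs))"
    then have k: "k < length bs" by simp
    then have "(bs ! k) i = 0 \<or> (bs ! k) i = c" using c(2) nth_mem by blast
    then have "(if (i, k) \<in> E then c else 0) = (bs ! k) i" using mem[OF k] by auto
    then show "report_truthfully E (\<lambda>_. c) i (report_truthfully F u i bs) ! k = bs ! k"
      using k by simp
  qed simp
  moreover have "E \<subseteq> UNIV \<times> {..<length bs}" by (auto simp: E_def)
  ultimately show thesis using that[of E "\<lambda>_. c"] c(1) mem by simp
qed

lemma assigned_cong_take:
  assumes "take (Suc k) bs = take (Suc k) bs'" and "k < length bs" and "k < length bs'"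
  shows "assigned M bs i k \<longleftrightarrow> assigned M bs' i k"
  using assms by (simp add: assigned_def)

lemma payment_le_if_same_prefix:
  fixes M :: "'b mechanism"
  assumes tardy: "tardy_mechanism H M" and truthful: "truthful H M"
    and rational: "individually_rational H M"
    and bs: "complete_bids H bs" and bs': "complete_bids H bs'"
    and "assigned M bs i k" and "assigned M bs' i k"
    and prefix: "take (Suc k) bs = take (Suc k) bs'"
  shows "payment M bs' i \<le> payment M bs i"
proof (rule ccontr)
  assume "\<not> ?thesis"
  then obtain w where w: "payment M bs i < w" "w < payment M bs' i"
    using dense[of "payment M bs i" "payment M bs' i"] by auto
  have "payment M bs i \<ge> 0" using tardy bs by (simp add: tardy_mechanism_def)
  with w have "w > 0" by simp
  have k: "k < length bs" "k < length bs'"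
    using assms(6,7) by (auto simp: assigned_def)
  define report where "report = report_truthfully {(i, k)} (\<lambda>_. w) i"
  have report: "complete_bids H (report cs)" if "complete_bids H cs" for cs
    using that \<open>w > 0\<close> by (simp add: complete_bids_def report_def valid_bids_report_truthfully)
  have inst: "is_instance H (length cs) {(i, k)} (\<lambda>_. w)"
    if "complete_bids H cs" "k < length cs" for cs :: "'b bids"
    using that \<open>w > 0\<close> by (auto simp: is_instance_def complete_bids_def)
  have win: "assigned M (report bs) i k"
  proof -
    have "utility M {(i, k)} (\<lambda>_. w) bs i \<le> utility M {(i, k)} (\<lambda>_. w) (report bs) i"
      using truthful inst[OF bs k(1)] bs unfolding truthful_def report_def complete_bids_def
      by blast
    moreover have "utility M {(i, k)} (\<lambda>_. w) bs i > 0"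
      using assms(6) w(1) by (simp add: utility_def)
    moreover have "payment M (report bs) i \<ge> 0"
      using tardy report[OF bs] by (simp add: tardy_mechanism_def)
    \<comment> \<open>With nonnegative payments, positive utility requires winning an item of
      interest, and \<open>k\<close> is the only one.\<close>
    ultimately show ?thesis by (auto simp: utility_def of_bool_def split: if_splits)
  qed
  have "take (Suc k) (report bs) = take (Suc k) (report bs')"
    by (simp only: report_def take_report_truthfully prefix)
  with win k have win': "assigned M (report bs') i k"
    using assigned_cong_take[of k "report bs" "report bs'"] by (simp add: report_def)
  have "0 \<le> utility M {(i, k)} (\<lambda>_. w) (report bs') i"
    using rational inst[OF bs' k(2)] bs'
    unfolding individually_rational_def report_def complete_bids_def by blast
  with win' have cheap: "payment M (report bs') i \<le> w"
    by (simp add: utility_def)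
  \<comment> \<open>Now take the type \<open>E\<close>, \<open>v\<close> whose honest report is
    \<open>bs'\<close>; for it, \<open>report bs'\<close> is a deviation.\<close>
  have "valid_bids bs'" using bs' by (simp add: complete_bids_def)
  then obtain E v where E: "E \<subseteq> UNIV \<times> {..<length bs'}" "\<forall>j. v j \<ge> 0"
    "\<And>k. k < length bs' \<Longrightarrow> (i, k) \<in> E \<longleftrightarrow> (bs' ! k) i \<noteq> 0"
    "\<And>F u. report_truthfully E v i (report_truthfully F u i bs') = bs'"
    by (rule valid_bids_eq_report_truthfully[of bs' i]) blast
  have "(bs' ! k) i \<noteq> 0"
    using tardy bs' assms(7) by (auto simp: tardy_mechanism_def)
  then have "(i, k) \<in> E" using E(3) k(2) by simp
  have "is_instance H (length bs') E v"
    using E bs' by (simp add: is_instance_def complete_bids_def)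
  moreover have "valid_bids (report bs')" "length (report bs') = length bs'"
    using report[OF bs'] by (simp_all add: complete_bids_def report_def)
  ultimately have "utility M E v (report bs') i
      \<le> utility M E v (report_truthfully E v i (report bs')) i"
    using truthful unfolding truthful_def by blast
  then have "utility M E v (report bs') i \<le> utility M E v bs' i"
    by (simp only: report_def E(4))
  \<comment> \<open>Both \<open>bs'\<close> and \<open>report bs'\<close> give \<open>k\<close> to
    \<open>i\<close>, so only the payments are compared and \<open>v i\<close> cancels.\<close>
  moreover have "utility M E v cs i = v i - payment M cs i" if "assigned M cs i k" for cs
    using that \<open>(i, k) \<in> E\<close> by (auto simp: utility_def)
  ultimately show False using win' assms(7) cheap w(2) by simp
qed

theorem lemma5:
  fixes H :: "nat set" and M :: "'b::finite mechanism"
  assumes "tardy_mechanism H M"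
    and "truthful H M"
    and "individually_rational H M"
  shows "prompt H M"
proof -
  \<comment> \<open>A price may depend on the history \<open>h\<close> alone, so it is read off from
    an arbitrarily chosen completion of \<open>h\<close>, possibly of another length than the actual
    one. The last item of \<open>h\<close> has index \<open>length h - 1\<close>.\<close>
  define wins where "wins h i bs \<longleftrightarrow> complete_bids H bs \<and> take (length h) bs = h
    \<and> assigned M bs i (length h - 1)" for h i bs
  define price where "price h i = payment M (SOME bs. wins h i bs) i" for h i
  have "payment M bs i = price (take (Suc k) bs) i"
    if "complete_bids H bs" and "assigned M bs i k" for bs i k
  proof -
    have "k < length bs" using that(2) by (simp add: assigned_def)
    then have wins: "wins (take (Suc k) bs) i cs \<longleftrightarrow> complete_bids H cs
        \<and> take (Suc k) cs = take (Suc k) bs \<and> assigned M cs i k" for cs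
      by (simp add: wins_def min_absorb2)
    then have "wins (take (Suc k) bs) i bs" using that by simp
    then have "wins (take (Suc k) bs) i (SOME cs. wins (take (Suc k) bs) i cs)"
      by (rule someI)
    then have same: "complete_bids H cs" "take (Suc k) cs = take (Suc k) bs" "assigned M cs i k"
      if "cs = (SOME cs. wins (take (Suc k) bs) i cs)" for cs
      using that wins by simp_all
    show ?thesis
      unfolding price_def
      \<comment> \<open>The actual and the chosen completion play symmetric roles, so the inequality
        applies in both directions.\<close>
      using payment_le_if_same_prefix[OF assms] that same[OF refl] by (intro order_antisym) simp_all
  qed
  then show ?thesis unfolding prompt_def by blast
qed

end
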